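(* Let $K$ be a convex shape in the plane, and let $\gamma$ be a curve in the plane passing through all extreme points of $K$. Then $$\operatorname{length} \gamma \geq \operatorname{per} K - \operatorname{diam} K.$$
   Context: A convex shape is a compact convex subset of the Euclidean plane $\mathbb{R}^2$ with non-empty interior. $\operatorname{per} K$ denotes the perimeter of $K$, i.e. the length of its boundary curve, and $\operatorname{diam} K$ is the maximal Euclidean distance between two points of $K$. A point of a convex shape $K$ is called extreme if it does not belong to any open line segment with endpoints in $K$. All curves are continuous and rectifiable (of finite length); $\gamma$ is not required to be closed or to stay inside $K$. *)

theory Defs
  imports "HOL-Analysis.Analysis"
begin

definition convex_shape :: "(real^2) set \<Rightarrow> bool" where
  "convex_shape K \<longleftrightarrow> compact K \<and> convex K \<and> interior K \<noteq> {}"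

text \<open>Length of a curve parametrized by \<open>{0..1}\<close>: the supremum of the lengths of inscribed
  polygonal lines, possibly infinite.\<close>

definition path_length :: "(real \<Rightarrow> 'a::metric_space) \<Rightarrow> ereal" where
  "path_length g =
     (SUP (n, t) \<in> {(n::nat, t::nat \<Rightarrow> real). mono_on {..n} t \<and> t ` {..n} \<subseteq> {0..1}}.
        ereal (\<Sum>i<n. dist (g (t i)) (g (t (Suc i)))))"

definition rectifiable_path :: "(real \<Rightarrow> 'a::metric_space) \<Rightarrow> bool" where
  "rectifiable_path g \<longleftrightarrow> path g \<and> path_length g < \<infinity>"

definition boundary_curve :: "(real \<Rightarrow> real^2) \<Rightarrow> (real^2) set \<Rightarrow> bool" where
  "boundary_curve b K \<longleftrightarrow>
     simple_path b \<and> pathfinish b = pathstart b \<and> path_image b = frontier K"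

text \<open>The choice of the simple closed parametrization of the boundary is immaterial, since it
  does not affect the length. One exists for every convex shape:\<close>

lemma boundary_curve_exists:
  assumes "convex_shape K"
  shows "\<exists>b. boundary_curve b K"
proof -
  let ?c = "\<lambda>t::real. cis (2 * pi * t)"
  have K: "compact K" "convex K" "interior K \<noteq> {}"
    using assms by (auto simp: convex_shape_def)
  have im: "?c ` {0..1} = sphere 0 1"
  proof
    show "sphere 0 1 \<subseteq> ?c ` {0..1}"
    proof
      fix z :: complex assume "z \<in> sphere 0 1"
      then have z: "cis (Arg2pi z) = z"
        using Arg2pi_eq[of z] by (simp add: cis_conv_exp)
      show "z \<in> ?c ` {0..1}"
        using z Arg2pi_ge_0[of z] Arg2pi_lt_2pi[of z]
        by (intro image_eqI[of _ _ "Arg2pi z / (2*pi)"]) (auto simp: field_simps)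
    qed
  qed auto
  have simple: "simple_path ?c"
    unfolding simple_path_def loop_free_def
  proof (intro conjI ballI impI)
    show "path ?c" unfolding path_def by (intro continuous_intros)
    fix x y :: real assume xy: "x \<in> {0..1}" "y \<in> {0..1}" "?c x = ?c y"
    then have "exp (\<i> * of_real (2*pi*x)) = exp (\<i> * of_real (2*pi*y))"
      by (simp add: cis_conv_exp)
    then obtain n :: int where "\<i> * of_real (2*pi*x) = \<i> * of_real (2*pi*y) + (of_int (2*n) * pi) * \<i>"
      by (auto simp: exp_eq)
    then have "2*pi*x = 2*pi*y + 2*n*pi"
      by (auto simp: complex_eq_iff)
    then have "2*pi*(x - y - of_int n) = 0" by (simp add: algebra_simps)
    then have n: "x - y = of_int n" by simp
    with xy have "\<bar>of_int n :: real\<bar> \<le> 1" by auto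
    then have "n = -1 \<or> n = 0 \<or> n = 1" by linarith
    with n xy show "x = y \<or> x = 0 \<and> y = 1 \<or> x = 1 \<and> y = 0" by auto
  qed
  have "aff_dim K = aff_dim (cball (0::complex) 1)"
    using K by (simp add: aff_dim_nonempty_interior aff_dim_cball)
  then have "rel_frontier (cball (0::complex) 1) homeomorphic rel_frontier K"
    using K by (intro homeomorphic_rel_frontiers_convex_bounded_sets)
      (auto simp: compact_imp_bounded)
  then have "sphere (0::complex) 1 homeomorphic frontier K"
    using K by (simp add: rel_frontier_nonempty_interior rel_frontier_cball)
  then obtain f g where h: "homeomorphism (sphere (0::complex) 1) (frontier K) f g"
    by (auto simp: homeomorphic_def)
  have inj: "inj_on f (sphere 0 1)"
    using h by (metis homeomorphism_def inj_on_inverseI)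
  have "simple_path (f \<circ> ?c)"
    using simple h inj im
    by (intro simple_path_continuous_image) (auto simp: path_image_def homeomorphism_def)
  moreover have "path_image (f \<circ> ?c) = frontier K"
    using h im by (metis homeomorphism_def path_image_compose path_image_def)
  ultimately show ?thesis
    by (intro exI[of _ "f \<circ> ?c"]) (auto simp: boundary_curve_def pathstart_def pathfinish_def)
qed

definition perimeter :: "(real^2) set \<Rightarrow> ereal" where
  "perimeter K = path_length (SOME b. boundary_curve b K)"

end

theory Submission
  imports Defs
begin

text \<open>A curve that visits all extreme points of \<open>K\<close> has an inscribed polygon whose vertices are
  extreme points and whose convex hull is \<open>K\<close>, up to an arbitrarily small error. Closed up by the
  segment between its first and last vertex, this polygon is at least as long as the boundary of
  \<open>K\<close>, up to the error; and the added segment joins two points of \<open>K\<close>, so it costs at most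
  \<open>diameter K\<close>.

  The comparison of the two closed curves goes by projection to lines. By the Cauchy--Crofton
  formula (\<open>crofton\<close>), the length of a vector is half the integral, over the directions \<open>u\<close> of
  a half circle, of \<open>\<bar>u \<bullet> v\<bar>\<close>. An inequality between the total variations of all projections
  of two polygons therefore implies the same inequality between their lengths
  (\<open>sum_norm_le_of_projections\<close>). For a fixed direction \<open>u\<close>, let \<open>W\<close> be the width of \<open>K\<close>, that
  is, the length of its projection.

  A polygon inscribed in the boundary has projected variation at most \<open>2 * W\<close>
  (\<open>projected_boundary_variation_le\<close>): almost every value is taken by \<open>u \<bullet> b\<close> at most twice,
  because a line through the interior of \<open>K\<close> meets the boundary in at most two points.

  A closed polygon has projected variation at least twice the distance of the projections of
  any two of its vertices (\<open>closed_tour_ge_twice_distance\<close>). The projection attains its extrema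
  over \<open>K\<close> at extreme points, so this is nearly \<open>2 * W\<close> for a polygon whose vertices form a
  fine net of the extreme points. A finite net suffices for all directions at once, with a
  uniform error, and the curve visits it in some order; this gives
  \<open>inscribed_boundary_polygon_le\<close>.\<close>

section \<open>Length as an average of projections\<close>

text \<open>Reflection \<open>v \<mapsto> - v\<close> reduces Crofton's formula to vectors with angle in the half turn over
  which the directions are averaged; the absolute value then changes sign only once, at
  \<open>\<theta> = \<phi>\<close>.\<close>

lemma has_integral_abs_rotated_sin:
  assumes "0 \<le> \<phi>" "\<phi> \<le> pi"
  shows "((\<lambda>\<theta>. \<bar>sin (\<phi> - \<theta>)\<bar>) has_integral 2) {0..pi}"
proof -
  have "((\<lambda>\<theta>. sin (\<phi> - \<theta>)) has_integral (cos (\<phi> - \<phi>) - cos (\<phi> - 0))) {0..\<phi>}"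
    using assms
    by (intro fundamental_theorem_of_calculus)
       (auto intro!: derivative_eq_intros simp flip: has_real_derivative_iff_has_vector_derivative)
  then have left: "((\<lambda>\<theta>. \<bar>sin (\<phi> - \<theta>)\<bar>) has_integral (1 - cos \<phi>)) {0..\<phi>}"
    using assms by (subst has_integral_cong[where g = "\<lambda>\<theta>. sin (\<phi> - \<theta>)"]) (auto intro!: abs_of_nonneg sin_ge_zero)
  have "((\<lambda>\<theta>. sin (\<theta> - \<phi>)) has_integral (- cos (pi - \<phi>) - - cos (\<phi> - \<phi>))) {\<phi>..pi}"
    using assms
    by (intro fundamental_theorem_of_calculus)
       (auto intro!: derivative_eq_intros simp flip: has_real_derivative_iff_has_vector_derivative)
  moreover have "\<bar>sin (\<phi> - \<theta>)\<bar> = sin (\<theta> - \<phi>)" if "\<theta> \<in> {\<phi>..pi}" for \<theta>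
    using that assms sin_ge_zero[of "\<theta> - \<phi>"] sin_minus[of "\<theta> - \<phi>"] by simp
  ultimately have right: "((\<lambda>\<theta>. \<bar>sin (\<phi> - \<theta>)\<bar>) has_integral (1 + cos \<phi>)) {\<phi>..pi}"
    by (subst has_integral_cong[where g = "\<lambda>\<theta>. sin (\<theta> - \<phi>)"]) (auto simp: add.commute)
  show ?thesis
    using has_integral_combine[OF assms left right] by simp
qed

text \<open>Half a turn is enough, since \<open>u\<close> and \<open>- u\<close> give the same projected length. With directions
  normal to the angle \<open>\<theta>\<close>, a vector of angle \<open>\<phi>\<close> projects to a multiple of \<open>sin (\<phi> - \<theta>)\<close>.\<close>

lemma crofton:
  fixes v :: "real^2"
  shows "((\<lambda>\<theta>. \<bar>vector [- sin \<theta>, cos \<theta>] \<bullet> v\<bar>) has_integral 2 * norm v) {0..pi}"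
proof -
  have upper: "((\<lambda>\<theta>. \<bar>vector [- sin \<theta>, cos \<theta>] \<bullet> v\<bar>) has_integral 2 * norm v) {0..pi}"
    if v: "v $ 2 \<ge> 0" "v \<noteq> 0" for v :: "real^2"
  proof -
    have norm: "norm v ^ 2 = (v $ 1)\<^sup>2 + (v $ 2)\<^sup>2"
      by (simp only: power2_norm_eq_inner inner_vec_def sum_2) (simp add: power2_eq_square)
    have "(v $ 1 / norm v)\<^sup>2 + (v $ 2 / norm v)\<^sup>2 = 1"
      unfolding power_divide add_divide_distrib[symmetric] norm[symmetric] using that by simp
    then obtain \<phi> where \<phi>: "0 \<le> \<phi>" "\<phi> \<le> pi" "v $ 1 / norm v = cos \<phi>" "v $ 2 / norm v = sin \<phi>"
      using sincos_total_pi[of "v $ 2 / norm v" "v $ 1 / norm v"] v by auto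
    have "v $ 1 = norm v * cos \<phi>" "v $ 2 = norm v * sin \<phi>"
      using \<phi> that by (auto simp: field_simps)
    then have "vector [- sin \<theta>, cos \<theta>] \<bullet> v = norm v * sin (\<phi> - \<theta>)" for \<theta>
      by (simp add: inner_vec_def sum_2 sin_diff algebra_simps)
    then show ?thesis
      using has_integral_mult_right[OF has_integral_abs_rotated_sin[OF \<phi>(1,2)], of "norm v"]
      by (simp add: abs_mult mult.commute)
  qed
  show ?thesis
  proof (cases "v = 0")
    case False
    then show ?thesis
      using upper[of v] upper[of "- v"] by (cases "v $ 2 \<ge> 0") auto
  qed auto
qed

text \<open>Crofton's formula is linear in the projected lengths, so only finite sums have to be
  integrated. The error term \<open>\<delta>\<close> accounts for replacing all extreme points by a finite net.\<close>

lemma sum_norm_le_of_projections: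
  fixes v :: "'a \<Rightarrow> real^2" and w :: "'b \<Rightarrow> real^2"
  assumes "finite I" "finite J"
    and le: "\<And>u. norm u = 1 \<Longrightarrow> (\<Sum>i\<in>I. \<bar>u \<bullet> v i\<bar>) \<le> (\<Sum>j\<in>J. \<bar>u \<bullet> w j\<bar>) + \<delta>"
  shows "(\<Sum>i\<in>I. norm (v i)) \<le> (\<Sum>j\<in>J. norm (w j)) + pi / 2 * \<delta>"
proof -
  let ?u = "\<lambda>\<theta>. vector [- sin \<theta>, cos \<theta>] :: real^2"
  have unit: "norm (?u \<theta>) = 1" for \<theta>
    by (simp add: norm_eq_1 inner_vec_def sum_2 flip: power2_eq_square)
  have "((\<lambda>\<theta>. \<Sum>i\<in>I. \<bar>?u \<theta> \<bullet> v i\<bar>) has_integral (\<Sum>i\<in>I. 2 * norm (v i))) {0..pi}"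
    by (intro has_integral_sum crofton assms)
  moreover have "((\<lambda>\<theta>. (\<Sum>j\<in>J. \<bar>?u \<theta> \<bullet> w j\<bar>) + \<delta>)
      has_integral ((\<Sum>j\<in>J. 2 * norm (w j)) + pi * \<delta>)) {0..pi}"
    using has_integral_const_real[of \<delta> 0 pi]
    by (intro has_integral_add has_integral_sum crofton assms) auto
  ultimately have "(\<Sum>i\<in>I. 2 * norm (v i)) \<le> (\<Sum>j\<in>J. 2 * norm (w j)) + pi * \<delta>"
    by (rule has_integral_le) (use le unit in blast)
  then show ?thesis
    by (simp flip: sum_distrib_left)
qed

section \<open>Lines meeting the boundary of a convex set\<close>

text \<open>The nearer of two boundary points on a ray from \<open>z\<close> would lie strictly between an interior
  point and a point of the closure, hence in the interior.\<close>

lemma ray_meets_frontier_once: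
  fixes K :: "'a::euclidean_space set"
  assumes "convex K" "z \<in> interior K" "z + \<alpha> *\<^sub>R w \<in> frontier K" "z + \<beta> *\<^sub>R w \<in> frontier K"
    and "0 < \<alpha>" "0 < \<beta>"
  shows "\<alpha> = \<beta>"
proof -
  have False if "z + \<alpha> *\<^sub>R w \<in> frontier K" "z + \<beta> *\<^sub>R w \<in> frontier K" "0 < \<alpha>" "\<alpha> < \<beta>" for \<alpha> \<beta>
  proof -
    have "w \<noteq> 0"
      using that(1) assms(2) by (auto simp: frontier_def)
    then have "z + \<alpha> *\<^sub>R w \<in> open_segment z (z + \<beta> *\<^sub>R w)"
      using that by (auto simp: in_segment algebra_simps intro!: exI[of _ "\<alpha> / \<beta>"])
    moreover have "open_segment z (z + \<beta> *\<^sub>R w) \<subseteq> interior K"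
      using that assms by (intro in_interior_closure_convex_segment) (auto simp: frontier_def)
    ultimately show False
      using that(1) by (auto simp: frontier_def)
  qed
  from this[of \<alpha> \<beta>] this[of \<beta> \<alpha>] show ?thesis
    using assms by fastforce
qed

text \<open>Each of the two opposite rays from \<open>z\<close> that form the line contains at most one boundary point.\<close>

lemma line_through_interior_meets_frontier_at_most_twice:
  fixes K :: "(real^2) set"
  assumes K: "convex K" and z: "z \<in> interior K" and "u \<noteq> 0"
    and on_line: "u \<bullet> p = u \<bullet> z" "u \<bullet> q = u \<bullet> z" "u \<bullet> r = u \<bullet> z"
    and fr: "p \<in> frontier K" "q \<in> frontier K" "r \<in> frontier K"
  shows "p = q \<or> q = r \<or> p = r"
proof -
  \<comment> \<open>In the plane, the line orthogonal to \<open>u\<close> is spanned by \<open>u\<close> turned by a right angle.\<close>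
  define w :: "real^2" where "w = vector [- u $ 2, u $ 1]"
  have param: "\<exists>\<alpha>. x = z + \<alpha> *\<^sub>R w \<and> \<alpha> \<noteq> 0"
    if "u \<bullet> x = u \<bullet> z" "x \<in> frontier K" for x
  proof -
    let ?d = "x - z"
    have uu: "u \<bullet> u \<noteq> 0" using \<open>u \<noteq> 0\<close> by simp
    have orth: "u $ 1 * ?d $ 1 + u $ 2 * ?d $ 2 = 0"
      using that by (simp add: inner_vec_def sum_2 algebra_simps)
    have "(u \<bullet> u) *\<^sub>R ?d = (w \<bullet> ?d) *\<^sub>R w"
      unfolding vec_eq_iff forall_2 using orth
      by (simp add: inner_vec_def sum_2 w_def) algebra
    then have "?d = ((w \<bullet> ?d) / (u \<bullet> u)) *\<^sub>R w"
      using uu by (metis (no_types, lifting) divide_inverse_commute scaleR_one scaleR_scaleR left_inverse)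
    then have "x = z + ((w \<bullet> ?d) / (u \<bullet> u)) *\<^sub>R w"
      by (metis add_diff_cancel_left' diff_add_cancel add.commute)
    moreover have "x \<noteq> z"
      using that(2) z by (auto simp: frontier_def)
    ultimately show ?thesis
      by (metis add_0_right scaleR_zero_left)
  qed
  obtain \<alpha> \<beta> \<gamma> where abc: "p = z + \<alpha> *\<^sub>R w" "q = z + \<beta> *\<^sub>R w" "r = z + \<gamma> *\<^sub>R w"
    "\<alpha> \<noteq> 0" "\<beta> \<noteq> 0" "\<gamma> \<noteq> 0"
    using param on_line fr by metis
  have pos: "\<rho> = \<sigma>" if "z + \<rho> *\<^sub>R w \<in> frontier K" "z + \<sigma> *\<^sub>R w \<in> frontier K" "0 < \<rho>" "0 < \<sigma>" for \<rho> \<sigma>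
    using ray_meets_frontier_once[OF K z] that by blast
  have neg: "\<rho> = \<sigma>" if "z + \<rho> *\<^sub>R w \<in> frontier K" "z + \<sigma> *\<^sub>R w \<in> frontier K" "\<rho> < 0" "\<sigma> < 0" for \<rho> \<sigma>
    using ray_meets_frontier_once[OF K z, of "- \<rho>" "- w" "- \<sigma>"] that by simp
  \<comment> \<open>Two of the three nonzero parameters have the same sign.\<close>
  consider "0 < \<alpha> \<and> 0 < \<beta> \<or> \<alpha> < 0 \<and> \<beta> < 0" | "0 < \<beta> \<and> 0 < \<gamma> \<or> \<beta> < 0 \<and> \<gamma> < 0"
    | "0 < \<alpha> \<and> 0 < \<gamma> \<or> \<alpha> < 0 \<and> \<gamma> < 0"
    using abc(4-6) by linarith
  then show ?thesis
    using pos neg fr unfolding abc(1-3) by cases metis+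
qed

text \<open>Strict separation leaves room to move \<open>x\<close> and \<open>y\<close> into the interior, which is dense in \<open>K\<close>
  and connected.\<close>

lemma interior_point_on_separating_hyperplane:
  fixes K :: "'a::euclidean_space set"
  assumes "convex K" "interior K \<noteq> {}" "x \<in> K" "y \<in> K" "u \<bullet> x < c" "c < u \<bullet> y"
  obtains z where "z \<in> interior K" "u \<bullet> z = c"
proof -
  have dense: "K \<subseteq> closure (interior K)"
    using assms convex_closure_interior closure_subset by metis
  have meets: "interior K \<inter> U \<noteq> {}" if "open U" "v \<in> U" "v \<in> K" for U v
    using open_Int_closure_eq_empty[OF \<open>open U\<close>, of "interior K"] dense that by blast
  have "interior K \<inter> {v. u \<bullet> v < c} \<noteq> {}" "interior K \<inter> {v. c < u \<bullet> v} \<noteq> {}"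
    using meets[OF open_halfspace_lt[of u c], of x] meets[OF open_halfspace_gt[of c u], of y] assms
    by simp_all
  then obtain x' y' where xy: "x' \<in> interior K" "y' \<in> interior K" "u \<bullet> x' < c" "c < u \<bullet> y'"
    by auto
  moreover have "connected (interior K)"
    using assms by (simp add: convex_connected convex_interior)
  ultimately show ?thesis
    using connected_ivt_hyperplane[of "interior K" x' y' u c] that by auto
qed

section \<open>The projection of the boundary\<close>

text \<open>Counting by levels instead of by steps: the sum of the step lengths is the integral over
  \<open>c\<close> of the number of steps that cross \<open>c\<close>. This is the discrete form of Banach's indicatrix
  formula.\<close>

lemma sum_interval_lengths_le_multiplicity:
  fixes a b :: "'i \<Rightarrow> real"
  assumes "finite I" and range: "\<And>i. i \<in> I \<Longrightarrow> a i \<in> {m..M} \<and> b i \<in> {m..M}" and "m \<le> M"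
    and mult: "\<And>c. card {i\<in>I. a i < c \<and> c < b i \<or> b i < c \<and> c < a i} \<le> k"
  shows "(\<Sum>i\<in>I. \<bar>b i - a i\<bar>) \<le> real k * (M - m)"
proof -
  let ?S = "\<lambda>i. {min (a i) (b i)<..<max (a i) (b i)}"
  have "(\<Sum>i\<in>I. \<bar>b i - a i\<bar>) = (\<Sum>i\<in>I. \<integral>c. indicator (?S i) c \<partial>lborel)"
    by (intro sum.cong) (auto simp: min_def max_def)
  also have "\<dots> = (\<integral>c. (\<Sum>i\<in>I. indicator (?S i) c) \<partial>lborel)"
    by (subst Bochner_Integration.integral_sum) auto
  also have "\<dots> \<le> (\<integral>c. real k * indicator {m..M} c \<partial>lborel)"
  proof (rule integral_mono)
    fix c :: real
    let ?C = "{i\<in>I. a i < c \<and> c < b i \<or> b i < c \<and> c < a i}"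
    have count: "(\<Sum>i\<in>I. indicator (?S i) c :: real) = real (card ?C)"
    proof -
      have "(\<Sum>i\<in>I. indicator (?S i) c :: real) = (\<Sum>i\<in>I. if a i < c \<and> c < b i \<or> b i < c \<and> c < a i then 1 else 0)"
        by (intro sum.cong) (auto simp: indicator_def min_def max_def)
      then show ?thesis
        using \<open>finite I\<close> by (simp add: sum.If_cases Int_def)
    qed
    show "(\<Sum>i\<in>I. indicator (?S i) c) \<le> real k * indicator {m..M} c"
    proof (cases "c \<in> {m..M}")
      case True
      then show ?thesis
        using count mult[of c] by simp
    next
      case False
      then have "?C = {}"
        using range by fastforce
      with count have "(\<Sum>i\<in>I. indicator (?S i) c :: real) = 0"
        by (simp only: card.empty of_nat_0)
      then show ?thesis by simp
    qed
  qed (auto intro!: integrable_mult_right integrable_real_indicator simp: emeasure_lborel_Icc_eq)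
  also have "\<dots> = real k * (M - m)"
    using \<open>m \<le> M\<close> by simp
  finally show ?thesis .
qed

text \<open>Each step that crosses a level \<open>c\<close> yields a parameter where \<open>b\<close> lies on the line
  \<open>u \<bullet> x = c\<close>. Different steps yield different parameters, hence different boundary points, since
  \<open>b\<close> is injective apart from its end points; and the line passes through the interior. So no level
  is crossed more than twice.\<close>

lemma projected_boundary_variation_le:
  assumes K: "convex_shape K" and b: "boundary_curve b K" and "u \<noteq> 0"
    and mono: "mono_on {..n} t" and t: "t ` {..n} \<subseteq> {0..1}"
    and mM: "\<And>x. x \<in> K \<Longrightarrow> m \<le> u \<bullet> x \<and> u \<bullet> x \<le> M"
  shows "(\<Sum>i<n. \<bar>u \<bullet> (b (t (Suc i)) - b (t i))\<bar>) \<le> 2 * (M - m)"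
proof -
  have conv: "convex K" "interior K \<noteq> {}" and "closed K"
    using K by (auto simp: convex_shape_def compact_imp_closed)
  have simple: "simple_path b" and image: "path_image b = frontier K"
    using b by (auto simp: boundary_curve_def)
  have t01: "t i \<in> {0..1}" if "i \<le> n" for i
    using t that by auto
  have bfr: "b s \<in> frontier K" if "s \<in> {0..1}" for s
    using image that by (auto simp: path_image_def)
  have bK: "b s \<in> K" if "s \<in> {0..1}" for s
    using bfr[OF that] \<open>closed K\<close> frontier_subset_closed by blast
  define h where "h s = u \<bullet> b s" for s
  have "continuous_on {0..1} b"
    using simple by (simp add: simple_path_def path_def)
  then have cont: "continuous_on {0..1} h"
    unfolding h_def by (intro continuous_intros)
  \<comment> \<open>The crossings are strict: this keeps the parameters away from the break points \<open>t i\<close>, so that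
    they differ from each other and from the parameters \<open>0\<close> and \<open>1\<close> that \<open>b\<close> identifies.\<close>
  define J where "J c = {i\<in>{..<n}. h (t i) < c \<and> c < h (t (Suc i)) \<or> h (t (Suc i)) < c \<and> c < h (t i)}" for c
  have "card (J c) \<le> 2" for c
  proof (rule ccontr)
    assume "\<not> ?thesis"
    then obtain T where T: "T \<subseteq> J c" "card T = 3"
      using obtain_subset_with_card_n[of 3 "J c"] by auto
    have crossing: "\<exists>s. t i < s \<and> s < t (Suc i) \<and> h s = c" if J: "i \<in> J c" for i
    proof -
      note that = J[unfolded J_def]
      have le: "t i \<le> t (Suc i)"
        using mono that by (auto intro!: mono_onD[OF mono])
      have sub: "{t i..t (Suc i)} \<subseteq> {0..1}"
        using t01[of i] t01[of "Suc i"] that by auto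
      have "\<exists>s\<ge>t i. s \<le> t (Suc i) \<and> h s = c"
        using that IVT'[of h "t i" c "t (Suc i)"] IVT2'[of h "t (Suc i)" c "t i"] le
          continuous_on_subset[OF cont sub] by auto
      then obtain s where s: "t i \<le> s" "s \<le> t (Suc i)" "h s = c" by auto
      moreover have "s \<noteq> t i" "s \<noteq> t (Suc i)"
        using that s by auto
      ultimately show ?thesis by force
    qed
    have J_less: "i < n" if "i \<in> J c" for i
      using that by (simp add: J_def)
    from crossing have "\<forall>i\<in>J c. \<exists>s. t i < s \<and> s < t (Suc i) \<and> h s = c"
      by blast
    then obtain s where s: "\<And>i. i \<in> J c \<Longrightarrow> t i < s i \<and> s i < t (Suc i) \<and> h (s i) = c"
      unfolding bchoice_iff by blast
    have s01: "0 < s i \<and> s i < 1" if "i \<in> J c" for i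
      using s[OF that] t01[of i] t01[of "Suc i"] J_less[OF that] by auto
    have s_less: "s i < s j" if "i \<in> J c" "j \<in> J c" "i < j" for i j
    proof -
      have "t (Suc i) \<le> t j"
        using J_less[of i] J_less[of j] that by (intro mono_onD[OF mono]) auto
      then show ?thesis
        using s[OF that(1)] s[OF that(2)] by linarith
    qed
    have inj: "b (s i) \<noteq> b (s j)" if ij: "i \<in> J c" "j \<in> J c" "i \<noteq> j" for i j
    proof
      assume eq: "b (s i) = b (s j)"
      have "s i \<in> {0..1}" "s j \<in> {0..1}"
        using s01[OF ij(1)] s01[OF ij(2)] by auto
      then have "s i = s j \<or> s i = 0 \<and> s j = 1 \<or> s i = 1 \<and> s j = 0"
        using simple eq unfolding simple_path_def loop_free_def by blast
      then have "s i = s j"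
        using s01[OF ij(1)] s01[OF ij(2)] by auto
      then show False
        using s_less[of i j] s_less[of j i] ij by (metis less_irrefl linorder_neqE_nat)
    qed
    obtain i j k where ijk: "i \<in> J c" "j \<in> J c" "k \<in> J c" "i \<noteq> j" "j \<noteq> k" "i \<noteq> k"
      using T unfolding card_3_iff by auto
    obtain z where z: "z \<in> interior K" "u \<bullet> z = c"
    proof -
      have "b (t i) \<in> K" "b (t (Suc i)) \<in> K"
        using J_less[OF ijk(1)] bK t01 by auto
      moreover have "u \<bullet> b (t i) < c \<and> c < u \<bullet> b (t (Suc i)) \<or> u \<bullet> b (t (Suc i)) < c \<and> c < u \<bullet> b (t i)"
        using ijk(1) by (simp add: h_def J_def)
      ultimately show ?thesis
        using interior_point_on_separating_hyperplane[OF conv] that by metis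
    qed
    have on: "u \<bullet> b (s i) = u \<bullet> z \<and> b (s i) \<in> frontier K" if "i \<in> J c" for i
      using s[OF that] s01[OF that] bfr[of "s i"] z by (auto simp: h_def)
    show False
      using line_through_interior_meets_frontier_at_most_twice[OF conv(1) z(1) \<open>u \<noteq> 0\<close>]
        on[OF ijk(1)] on[OF ijk(2)] on[OF ijk(3)] inj ijk by metis
  qed
  moreover have "m \<le> M"
    using mM[OF bK[of 0]] by simp
  moreover have "h (t i) \<in> {m..M} \<and> h (t (Suc i)) \<in> {m..M}" if "i \<in> {..<n}" for i
    using that mM[OF bK[OF t01[of i]]] mM[OF bK[OF t01[of "Suc i"]]] by (auto simp: h_def)
  ultimately have "(\<Sum>i<n. \<bar>h (t (Suc i)) - h (t i)\<bar>) \<le> real 2 * (M - m)"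
    unfolding J_def by (intro sum_interval_lengths_le_multiplicity) auto
  then show ?thesis
    by (simp add: h_def inner_diff_right)
qed

section \<open>Closed polygons through the extreme points\<close>

lemma abs_diff_le_sum_abs_steps:
  fixes y :: "nat \<Rightarrow> real"
  assumes "i \<le> j"
  shows "\<bar>y j - y i\<bar> \<le> (\<Sum>k=i..<j. \<bar>y (Suc k) - y k\<bar>)"
  using sum_abs[of "\<lambda>k. y (Suc k) - y k" "{i..<j}"] by (simp add: sum_Suc_diff' assms)

text \<open>The two vertices cut the closed tour into two arcs, and each arc covers their distance.\<close>

lemma closed_tour_ge_twice_distance:
  fixes y :: "nat \<Rightarrow> real"
  assumes "i \<le> m" "j \<le> m"
  shows "2 * \<bar>y j - y i\<bar> \<le> (\<Sum>k<m. \<bar>y (Suc k) - y k\<bar>) + \<bar>y 0 - y m\<bar>"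
proof -
  have ordered: "2 * \<bar>y j - y i\<bar> \<le> (\<Sum>k<m. \<bar>y (Suc k) - y k\<bar>) + \<bar>y 0 - y m\<bar>"
    if "i \<le> j" "j \<le> m" for i j
  proof -
    let ?S = "\<lambda>i j. \<Sum>k=i..<j. \<bar>y (Suc k) - y k\<bar>"
    have split: "(\<Sum>k<m. \<bar>y (Suc k) - y k\<bar>) = ?S 0 i + ?S i j + ?S j m"
      using that by (simp add: sum.atLeastLessThan_concat atLeast0LessThan[symmetric])
    have around: "\<bar>y j - y i\<bar> \<le> \<bar>y i - y 0\<bar> + \<bar>y 0 - y m\<bar> + \<bar>y m - y j\<bar>"
      by arith
    show ?thesis
      using split around abs_diff_le_sum_abs_steps[OF le0, of y i]
        abs_diff_le_sum_abs_steps[OF that(1), of y] abs_diff_le_sum_abs_steps[OF that(2), of y]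
      by argo
  qed
  show ?thesis
    using ordered[of i j] ordered[of j i] assms by (cases "i \<le> j") (auto simp: abs_minus_commute)
qed

text \<open>The maximizers form a face; an extreme point of the face is an extreme point of \<open>K\<close>.\<close>

lemma extreme_point_maximizing_inner:
  fixes K :: "'a::euclidean_space set"
  assumes "compact K" "convex K" "K \<noteq> {}"
  obtains p where "p extreme_point_of K" "\<And>x. x \<in> K \<Longrightarrow> u \<bullet> x \<le> u \<bullet> p"
proof -
  have "continuous_on K (\<lambda>x. u \<bullet> x)"
    by (intro continuous_intros)
  then obtain q where q: "q \<in> K" "\<And>x. x \<in> K \<Longrightarrow> u \<bullet> x \<le> u \<bullet> q"
    using continuous_attains_sup[OF assms(1,3)] by metis
  let ?F = "K \<inter> {x. u \<bullet> x = u \<bullet> q}"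
  have face: "?F face_of K"
    by (intro face_of_Int_supporting_hyperplane_le assms q)
  have "compact ?F" "convex ?F"
    using face assms face_of_imp_convex by (auto intro: compact_Int_closed closed_hyperplane)
  moreover have "?F \<noteq> {}"
    using q by auto
  ultimately obtain p where p: "p extreme_point_of ?F"
    by (meson extreme_point_exists_convex)
  then have "p \<in> ?F" "p extreme_point_of K"
    using extreme_point_of_face[OF face] by (auto simp: extreme_point_of_def)
  then show ?thesis
    using that q by auto
qed

text \<open>The net is chosen in \<open>A\<close> itself, although \<open>A\<close> need not be closed: balls around points of \<open>A\<close>
  already cover its compact closure.\<close>

lemma finite_net_of_bounded:
  fixes A :: "'a::euclidean_space set"
  assumes "bounded A" "0 < e"
  obtains F where "finite F" "F \<subseteq> A" "\<And>x. x \<in> A \<Longrightarrow> \<exists>p\<in>F. dist x p < e"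
proof -
  have "compact (closure A)"
    using assms by (simp add: compact_closure)
  moreover have "closure A \<subseteq> (\<Union>p\<in>A. ball p e)"
    using \<open>0 < e\<close> by (auto simp: closure_approachable)
  ultimately obtain F where "F \<subseteq> A" "finite F" "closure A \<subseteq> (\<Union>p\<in>F. ball p e)"
    by (meson compactE_image open_ball)
  then show ?thesis
    using that[of F] closure_subset[of A] by (auto simp: subset_iff dist_commute)
qed

lemma finite_subset_of_path_visited_in_order:
  assumes "finite F" "F \<noteq> {}" "F \<subseteq> path_image g"
  obtains m t where "mono_on {..m::nat} t" "t ` {..m} \<subseteq> {0..1}" "(\<lambda>i. g (t i)) ` {..m} = F"
proof -
  obtain T where T: "T \<subseteq> {0..1}" "finite T" "F = g ` T"
    using finite_subset_image[of F g "{0..1}"] assms by (auto simp: path_image_def)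
  define L where "L = sorted_list_of_set T"
  have L: "sorted L" "set L = T" "L \<noteq> []"
    using T assms by (auto simp: L_def)
  have idx: "i \<le> length L - 1 \<longleftrightarrow> i < length L" for i
    using L(3) by (cases L) auto
  have image: "(\<lambda>i. L ! i) ` {..length L - 1} = T"
    using L(2) idx by (auto simp: set_conv_nth image_def)
  show ?thesis
  proof (rule that[of "length L - 1" "\<lambda>i. L ! i"])
    show "mono_on {..length L - 1} (\<lambda>i. L ! i)"
      using L(1) idx by (auto intro!: mono_onI sorted_nth_mono)
    show "(\<lambda>i. g (L ! i)) ` {..length L - 1} = F"
      using image T(3) by (metis image_image)
  qed (use image T in auto)
qed

text \<open>The points of a finite \<open>e\<close>-net of the extreme points, in the order in which \<open>\<gamma>\<close> visits them,
  form a polygon inscribed in \<open>\<gamma>\<close>. Closed up, its width falls short of that of \<open>K\<close> by at most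
  \<open>2 * e\<close> in each direction, so its projected variation is at least twice the width of \<open>K\<close> minus
  \<open>4 * e\<close>. By Crofton's formula, this costs \<open>pi / 2 * (4 * e)\<close> in length.\<close>

lemma inscribed_boundary_polygon_le:
  fixes \<gamma> :: "real \<Rightarrow> real^2"
  assumes K: "convex_shape K" and b: "boundary_curve b K"
    and ext: "{x. x extreme_point_of K} \<subseteq> path_image \<gamma>"
    and mono: "mono_on {..n} t" and t: "t ` {..n} \<subseteq> {0..1}" and "0 < e"
  shows "ereal (\<Sum>i<n. dist (b (t i)) (b (t (Suc i))))
    \<le> path_length \<gamma> + ereal (diameter K) + ereal (2 * pi * e)"
proof -
  let ?E = "{x. x extreme_point_of K}"
  have K': "compact K" "convex K" "K \<noteq> {}"
    using K interior_subset by (auto simp: convex_shape_def)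
  have EK: "?E \<subseteq> K"
    by (auto simp: extreme_point_of_def)
  then have "bounded ?E"
    using K' compact_imp_bounded bounded_subset by blast
  then obtain F where F: "finite F" "F \<subseteq> ?E" "\<And>x. x \<in> ?E \<Longrightarrow> \<exists>p\<in>F. dist x p < e"
    using finite_net_of_bounded[OF _ \<open>0 < e\<close>] by metis
  have "?E \<noteq> {}"
    using extreme_point_maximizing_inner[OF K'] by blast
  then have "F \<noteq> {}"
    using F(3) by blast
  then obtain m s where s: "mono_on {..m::nat} s" "s ` {..m} \<subseteq> {0..1}" "(\<lambda>i. \<gamma> (s i)) ` {..m} = F"
    using finite_subset_of_path_visited_in_order[OF F(1)] F(2) ext by (metis subset_trans)
  define x where "x i = \<gamma> (s i)" for i
  \<comment> \<open>The edges of the closed polygon; the edge number \<open>m\<close> leads back to the start.\<close>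
  define w where "w j = (if j < m then x (Suc j) - x j else x 0 - x m)" for j
  have xF: "x ` {..m} = F"
    using s(3) by (simp add: x_def)
  have "(\<Sum>i<n. \<bar>u \<bullet> (b (t (Suc i)) - b (t i))\<bar>) \<le> (\<Sum>j\<le>m. \<bar>u \<bullet> w j\<bar>) + 4 * e"
    if u: "norm u = 1" for u
  proof -
    have near: "\<exists>i\<le>m. \<bar>u \<bullet> p - u \<bullet> x i\<bar> < e" if p: "p \<in> ?E" for p
    proof -
      obtain i where i: "i \<le> m" "dist p (x i) < e"
        using F(3)[OF p] xF by auto
      have "\<bar>u \<bullet> (p - x i)\<bar> \<le> norm (p - x i)"
        using Cauchy_Schwarz_ineq2[of u "p - x i"] u by simp
      then show ?thesis
        using i by (auto simp: dist_norm inner_diff_right intro!: exI[of _ i])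
    qed
    obtain p where p: "p \<in> ?E" "\<And>x. x \<in> K \<Longrightarrow> u \<bullet> x \<le> u \<bullet> p"
      using extreme_point_maximizing_inner[OF K', of u] by blast
    obtain q where q: "q \<in> ?E" "\<And>x. x \<in> K \<Longrightarrow> u \<bullet> q \<le> u \<bullet> x"
      using extreme_point_maximizing_inner[OF K', of "- u"]
      by (metis inner_minus_left neg_le_iff_le mem_Collect_eq)
    obtain i j where ij: "i \<le> m" "j \<le> m" "\<bar>u \<bullet> p - u \<bullet> x i\<bar> < e" "\<bar>u \<bullet> q - u \<bullet> x j\<bar> < e"
      using near p(1) q(1) by meson
    have "(\<Sum>i<n. \<bar>u \<bullet> (b (t (Suc i)) - b (t i))\<bar>) \<le> 2 * (u \<bullet> p - u \<bullet> q)"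
      using u p(2) q(2) by (intro projected_boundary_variation_le[OF K b _ mono t]) auto
    also have "\<dots> \<le> 2 * \<bar>u \<bullet> x i - u \<bullet> x j\<bar> + 4 * e"
      using ij(3,4) by argo
    also have "2 * \<bar>u \<bullet> x i - u \<bullet> x j\<bar> \<le> (\<Sum>k<m. \<bar>u \<bullet> x (Suc k) - u \<bullet> x k\<bar>) + \<bar>u \<bullet> x 0 - u \<bullet> x m\<bar>"
      using closed_tour_ge_twice_distance[OF ij(2,1)] .
    also have "\<dots> = (\<Sum>j\<le>m. \<bar>u \<bullet> w j\<bar>)"
      by (simp add: lessThan_Suc_atMost[symmetric] w_def inner_diff_right)
    finally show ?thesis by simp
  qed
  then have "(\<Sum>i<n. norm (b (t (Suc i)) - b (t i))) \<le> (\<Sum>j\<le>m. norm (w j)) + pi / 2 * (4 * e)"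
    by (intro sum_norm_le_of_projections) auto
  then have le: "(\<Sum>i<n. dist (b (t i)) (b (t (Suc i))))
      \<le> (\<Sum>k<m. dist (x k) (x (Suc k))) + dist (x 0) (x m) + 2 * pi * e"
    by (simp add: lessThan_Suc_atMost[symmetric] w_def dist_norm norm_minus_commute)
  have "x 0 \<in> K" "x m \<in> K"
    using xF F(2) EK by auto
  then have "dist (x 0) (x m) \<le> diameter K"
    using diameter_bounded_bound[OF compact_imp_bounded[OF K'(1)]] by blast
  moreover have "ereal (\<Sum>k<m. dist (x k) (x (Suc k))) \<le> path_length \<gamma>"
    unfolding path_length_def x_def using s by (intro SUP_upper2[of "(m, s)"]) auto
  ultimately have "ereal (\<Sum>k<m. dist (x k) (x (Suc k))) + ereal (dist (x 0) (x m)) + ereal (2 * pi * e)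
      \<le> path_length \<gamma> + ereal (diameter K) + ereal (2 * pi * e)"
    by (intro add_mono) auto
  with le show ?thesis
    by (metis (no_types, lifting) ereal_less_eq(3) order_trans plus_ereal.simps(1))
qed

theorem theorem7:
  fixes K :: "(real^2) set" and \<gamma> :: "real \<Rightarrow> real^2"
  assumes "convex_shape K"
    and "rectifiable_path \<gamma>"
    and "{x. x extreme_point_of K} \<subseteq> path_image \<gamma>"
  shows "path_length \<gamma> \<ge> perimeter K - ereal (diameter K)"
proof -
  define b where "b = (SOME b. boundary_curve b K)"
  have b: "boundary_curve b K"
    unfolding b_def using boundary_curve_exists[OF assms(1)] by (rule someI_ex)
  have "ereal (\<Sum>i<n. dist (b (t i)) (b (t (Suc i)))) \<le> path_length \<gamma> + ereal (diameter K)"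
    if "mono_on {..n} t" "t ` {..n} \<subseteq> {0..1}" for n and t :: "nat \<Rightarrow> real"
  proof (rule ereal_le_epsilon2)
    fix e :: real assume "0 < e"
    then show "ereal (\<Sum>i<n. dist (b (t i)) (b (t (Suc i)))) \<le> path_length \<gamma> + ereal (diameter K) + ereal e"
      using inscribed_boundary_polygon_le[OF assms(1) b assms(3) that, of "e / (2 * pi)"] by simp
  qed
  then have "perimeter K \<le> path_length \<gamma> + ereal (diameter K)"
    unfolding perimeter_def b_def[symmetric] path_length_def[of b] by (intro SUP_least) auto
  then show ?thesis
    by (simp add: ereal_minus_le_iff add.commute)
qed

end
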